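(* If $\ell$ is a positive integer, then the second central moment (variance) of the crosscorrelation demerit factor over all pairs of binary sequences of length $\ell$ (uniformly distributed) is \[ \mu^\ell_{2,(f,g)} \mathrm{CDF}(f,g) = \frac{4\ell^3 - 6\ell^2 + 2\ell}{3\ell^4}. \]
   Context: A binary sequence of length $\ell$ is a doubly infinite list $f=(f_j)_{j\in\mathbb{Z}}$ with $f_j\in\{-1,1\}$ for $0\le j\le \ell-1$ and $f_j=0$ for all other $j$. For sequences $f,g$ of complex numbers with finitely many nonzero terms and $s\in\mathbb{Z}$, the aperiodic crosscorrelation is $C_{f,g}(s)=\sum_{j\in\mathbb{Z}} f_{j+s}\overline{g_j}$. For nonzero $f,g$, the crosscorrelation demerit factor is \[ \mathrm{CDF}(f,g)=\frac{\sum_{s\in\mathbb{Z}}|C_{f,g}(s)|^2}{C_{f,f}(0)\,C_{g,g}(0)}. \] $\mathrm{Pair}(\ell)$ is the set of all $2^{2\ell}$ ordered pairs $(f,g)$ of binary sequences of length $\ell$, with uniform probability measure; $\mathbb{E}^\ell_{(f,g)} v(f,g)$ is the expected value of a random variable $v$ with respect to this measure, and its $p$th central moment is $\mu^\ell_{p,(f,g)} v(f,g)=\mathbb{E}^\ell_{(f,g)}\bigl(v(f,g)-\mathbb{E}^\ell_{(f,g)}v(f,g)\bigr)^p$. *)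

theory Defs
  imports "HOL-Probability.Probability"
begin

definition binary_seqs :: "nat \<Rightarrow> (int \<Rightarrow> complex) set" where
  "binary_seqs l = {f. (\<forall>j. 0 \<le> j \<and> j \<le> int l - 1 \<longrightarrow> f j \<in> {-1, 1}) \<and>
                       (\<forall>j. \<not> (0 \<le> j \<and> j \<le> int l - 1) \<longrightarrow> f j = 0)}"

(* For finitely supported f and g the infinite sums below have only finitely many nonzero terms. *)
definition crosscorr :: "(int \<Rightarrow> complex) \<Rightarrow> (int \<Rightarrow> complex) \<Rightarrow> int \<Rightarrow> complex" where
  "crosscorr f g s = (\<Sum>\<^sub>\<infinity>j. f (j + s) * cnj (g j))"

(* Re only adjusts the type: the zero-shift autocorrelations are real, see of_real_CDF. *)
definition CDF :: "(int \<Rightarrow> complex) \<Rightarrow> (int \<Rightarrow> complex) \<Rightarrow> real" where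
  "CDF f g = (\<Sum>\<^sub>\<infinity>s. (cmod (crosscorr f g s))\<^sup>2)
             / (Re (crosscorr f f 0) * Re (crosscorr g g 0))"

definition seq_pairs :: "nat \<Rightarrow> ((int \<Rightarrow> complex) \<times> (int \<Rightarrow> complex)) set" where
  "seq_pairs l = binary_seqs l \<times> binary_seqs l"

definition pair_expectation ::
  "nat \<Rightarrow> ((int \<Rightarrow> complex) \<times> (int \<Rightarrow> complex) \<Rightarrow> real) \<Rightarrow> real" where
  "pair_expectation l v = measure_pmf.expectation (pmf_of_set (seq_pairs l)) v"

definition central_moment ::
  "nat \<Rightarrow> nat \<Rightarrow> ((int \<Rightarrow> complex) \<times> (int \<Rightarrow> complex) \<Rightarrow> real) \<Rightarrow> real" where
  "central_moment p l v = pair_expectation l (\<lambda>x. (v x - pair_expectation l v) ^ p)"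

lemma crosscorr_self_0: "crosscorr f f 0 = of_real (Re (crosscorr f f 0))"
proof -
  have "cnj (crosscorr f f 0) = crosscorr f f 0"
    by (simp add: crosscorr_def infsum_cnj[symmetric] mult.commute del: infsum_cnj)
  then show ?thesis
    by (simp add: complex_eq_iff)
qed

lemma of_real_CDF:
  "of_real (CDF f g) = of_real (\<Sum>\<^sub>\<infinity>s. (cmod (crosscorr f g s))\<^sup>2)
     / (crosscorr f f 0 * crosscorr g g 0)"
  by (simp add: CDF_def crosscorr_self_0[symmetric])

lemma bij_betw_binary_seqs:
  "bij_betw (\<lambda>f. restrict f {0..<int l}) (binary_seqs l) ({0..<int l} \<rightarrow>\<^sub>E {-1, 1})"
  by (rule bij_betw_byWitness[where f' = "\<lambda>h j. if j \<in> {0..<int l} then h j else 0"])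
     (auto simp: binary_seqs_def fun_eq_iff PiE_def extensional_def Pi_def)

lemma card_binary_seqs: "card (binary_seqs l) = 2 ^ l"
  using bij_betw_same_card[OF bij_betw_binary_seqs[of l]] by (simp add: card_PiE numeral_2_eq_2)

lemma card_seq_pairs: "card (seq_pairs l) = 2 ^ (2 * l)"
  by (simp add: seq_pairs_def card_cartesian_product card_binary_seqs mult_2 power_add)

lemma finite_seq_pairs: "finite (seq_pairs l)" and seq_pairs_nonempty: "seq_pairs l \<noteq> {}"
  using card_seq_pairs[of l] by (auto intro: card_ge_0_finite)

end

theory Submission
  imports Defs
begin

text \<open>
  For real sequences the sum of the squared crosscorrelations equals the sum over all shifts of the
  products of the two autocorrelations, hence is \<open>l\<^sup>2\<close> plus twice the sum over the
  positive shifts. Under the uniform measure the autocorrelations at distinct positive shifts are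
  centred and uncorrelated, with variance \<open>l - d\<close> at shift \<open>d\<close>; by independence
  of the two sequences the variance of the sum is \<open>4 * (\<Sum>d=1..l. (l - d)\<^sup>2)\<close>.
\<close>

text \<open>Finite real form of the crosscorrelation for binary sequences. Only the index of
  \<open>g\<close> is restricted to the window \<open>{0..<int l}\<close>; the zeros of
  \<open>f\<close> outside the window cut off the shifted factor.\<close>

definition corr :: "nat \<Rightarrow> (int \<Rightarrow> complex) \<Rightarrow> (int \<Rightarrow> complex) \<Rightarrow> int \<Rightarrow> real" where
  "corr l f g s = (\<Sum>j\<in>{0..<int l}. Re (f (j + s)) * Re (g j))"

lemma binary_seqs_outside: "f \<in> binary_seqs l \<Longrightarrow> j \<notin> {0..<int l} \<Longrightarrow> f j = 0"
  by (auto simp: binary_seqs_def)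

lemma binary_seqs_Im: "f \<in> binary_seqs l \<Longrightarrow> Im (f j) = 0"
  by (cases "j \<in> {0..<int l}") (auto simp: binary_seqs_def)

lemma binary_seqs_Re_square:
  "f \<in> binary_seqs l \<Longrightarrow> (Re (f j))\<^sup>2 = (if j \<in> {0..<int l} then 1 else 0)"
  by (auto simp: binary_seqs_def)

lemma crosscorr_eq_corr:
  assumes "f \<in> binary_seqs l" "g \<in> binary_seqs l"
  shows "crosscorr f g s = of_real (corr l f g s)"
proof -
  have "crosscorr f g s = (\<Sum>\<^sub>\<infinity>j\<in>{0..<int l}. f (j + s) * cnj (g j))"
    unfolding crosscorr_def
    by (rule infsum_cong_neutral) (auto simp: binary_seqs_outside[OF assms(2)])
  also have "\<dots> = of_real (corr l f g s)"
    by (auto simp: corr_def complex_eq_iff binary_seqs_Im[OF assms(1)] binary_seqs_Im[OF assms(2)])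
  finally show ?thesis .
qed

text \<open>A shift by \<open>l\<close> or more moves the window off itself. This is what truncates
  the sum over all shifts to \<open>{- int l..int l}\<close>.\<close>

lemma corr_eq_0:
  assumes "f \<in> binary_seqs l" "\<bar>s\<bar> \<ge> int l"
  shows "corr l f g s = 0"
  unfolding corr_def
proof (intro sum.neutral ballI)
  fix j assume "j \<in> {0..<int l}"
  then have "f (j + s) = 0"
    using assms(2) by (intro binary_seqs_outside[OF assms(1)]) auto
  then show "Re (f (j + s)) * Re (g j) = 0"
    by simp
qed

lemma corr_self_0: "f \<in> binary_seqs l \<Longrightarrow> corr l f f 0 = real l"
  using binary_seqs_Re_square[of f l] by (simp add: corr_def power2_eq_square)

lemma corr_self_minus:
  assumes "f \<in> binary_seqs l"
  shows "corr l f f (- d) = corr l f f d"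
  unfolding corr_def
  \<comment> \<open>The translation by \<open>d\<close> does not preserve the window:
    \<open>S'\<close> and \<open>T'\<close> collect the indices whose translate leaves it, where
    \<open>f\<close> contributes a zero factor.\<close>
  by (rule sum.reindex_bij_witness_not_neutral[
        where i = "\<lambda>k. k + d" and j = "\<lambda>j. j - d"
          and S' = "{0..<int l} - {d..<int l + d}"
          and T' = "{0..<int l} - {- d..<int l - d}"])
     (auto simp: binary_seqs_outside[OF assms] mult.commute)

text \<open>For \<open>k\<close> in the window, the translated range from \<open>k - int l\<close>
  to \<open>k + int l\<close> still covers the whole support of \<open>h\<close>.\<close>

lemma sum_shift_supported:
  fixes h :: "int \<Rightarrow> real"
  assumes "\<And>j. j \<notin> {0..<int l} \<Longrightarrow> h j = 0" "k \<in> {0..<int l}"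
  shows "(\<Sum>s\<in>{- int l..int l}. h (k + s)) = (\<Sum>u\<in>{0..<int l}. h u)"
proof -
  have "(\<Sum>s\<in>{- int l..int l}. h (k + s)) = (\<Sum>u\<in>{k - int l..k + int l}. h u)"
    by (rule sum.reindex_bij_witness[where i = "\<lambda>u. u - k" and j = "\<lambda>s. k + s"]) auto
  also have "\<dots> = (\<Sum>u\<in>{0..<int l}. h u)"
    by (rule sum.mono_neutral_right) (use assms in auto)
  finally show ?thesis .
qed

text \<open>Both sides are the same sum over products of two entries of \<open>f\<close> and two of
  \<open>g\<close>, grouped differently: once \<open>g j\<close> and \<open>g k\<close> are fixed,
  summing over \<open>s\<close> gives the autocorrelation of \<open>f\<close> at
  \<open>j - k\<close>.\<close>

lemma sum_corr_square:
  assumes f: "f \<in> binary_seqs l" and g: "g \<in> binary_seqs l"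
  shows "(\<Sum>s\<in>{- int l..int l}. (corr l f g s)\<^sup>2)
    = (\<Sum>s\<in>{- int l..int l}. corr l f f s * corr l g g s)"
proof -
  let ?I = "{0..<int l}" and ?J = "{- int l..int l}"
  have "(\<Sum>s\<in>?J. (corr l f g s)\<^sup>2)
      = (\<Sum>s\<in>?J. \<Sum>k\<in>?I. \<Sum>j\<in>?I. Re (f (j + s)) * Re (g j) * (Re (f (k + s)) * Re (g k)))"
    unfolding corr_def power2_eq_square sum_product by (rule sum.cong[OF refl sum.swap])
  also have "\<dots> = (\<Sum>k\<in>?I. \<Sum>j\<in>?I. \<Sum>s\<in>?J.
      Re (f (j + s)) * Re (g j) * (Re (f (k + s)) * Re (g k)))"
    by (subst sum.swap, rule sum.cong[OF refl sum.swap])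
  also have "\<dots> = (\<Sum>k\<in>?I. \<Sum>j\<in>?I. Re (g j) * Re (g k) * corr l f f (j - k))"
  proof (intro sum.cong refl)
    fix k j assume k: "k \<in> ?I"
    have "(\<Sum>s\<in>?J. Re (f (j + s)) * Re (g j) * (Re (f (k + s)) * Re (g k)))
        = Re (g j) * Re (g k) * (\<Sum>s\<in>?J. Re (f (k + s + (j - k))) * Re (f (k + s)))"
      by (simp add: sum_distrib_left algebra_simps)
    also have "(\<Sum>s\<in>?J. Re (f (k + s + (j - k))) * Re (f (k + s))) = corr l f f (j - k)"
      unfolding corr_def
      by (rule sum_shift_supported[where h = "\<lambda>u. Re (f (u + (j - k))) * Re (f u)", OF _ k])
         (simp add: binary_seqs_outside[OF f])
    finally show "(\<Sum>s\<in>?J. Re (f (j + s)) * Re (g j) * (Re (f (k + s)) * Re (g k)))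
        = Re (g j) * Re (g k) * corr l f f (j - k)" .
  qed
  \<comment> \<open>The substitution \<open>j = k + s\<close> makes the difference the summation
    variable, so that the sum over \<open>k\<close> becomes the autocorrelation of
    \<open>g\<close>.\<close>
  also have "\<dots> = (\<Sum>k\<in>?I. \<Sum>s\<in>?J. Re (g (k + s)) * Re (g k) * corr l f f s)"
  proof (rule sum.cong[OF refl])
    fix k assume k: "k \<in> ?I"
    show "(\<Sum>j\<in>?I. Re (g j) * Re (g k) * corr l f f (j - k))
        = (\<Sum>s\<in>?J. Re (g (k + s)) * Re (g k) * corr l f f s)"
      using sum_shift_supported[where h = "\<lambda>j. Re (g j) * Re (g k) * corr l f f (j - k)", OF _ k]
      by (simp add: binary_seqs_outside[OF g])
  qed
  also have "\<dots> = (\<Sum>s\<in>?J. corr l f f s * corr l g g s)"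
    by (subst sum.swap) (simp add: corr_def[of l g] sum_distrib_left mult_ac)
  finally show ?thesis .
qed

lemma sum_corr_square_split:
  assumes f: "f \<in> binary_seqs l" and g: "g \<in> binary_seqs l"
  shows "(\<Sum>s\<in>{- int l..int l}. (corr l f g s)\<^sup>2)
    = real l ^ 2 + 2 * (\<Sum>d\<in>{1..int l}. corr l f f d * corr l g g d)"
proof -
  let ?h = "\<lambda>s. corr l f f s * corr l g g s"
  have J: "{- int l..int l} = insert 0 ({- int l..-1} \<union> {1..int l})"
    by auto
  have "sum ?h {- int l..-1} = sum ?h {1..int l}"
    by (rule sum.reindex_bij_witness[where i = uminus and j = uminus])
       (auto simp: corr_self_minus[OF f] corr_self_minus[OF g])
  then have "sum ?h {- int l..int l} = ?h 0 + 2 * sum ?h {1..int l}"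
    unfolding J by (subst sum.insert) (auto simp: sum.union_disjoint)
  moreover have "?h 0 = real l ^ 2"
    by (simp add: corr_self_0[OF f] corr_self_0[OF g] power2_eq_square)
  ultimately show ?thesis
    by (simp only: sum_corr_square[OF f g])
qed

text \<open>Separates the zero-shift term 1, which turns out to be the mean, from the fluctuating
  part.\<close>

lemma CDF_eq:
  assumes "f \<in> binary_seqs l" "g \<in> binary_seqs l" "l > 0"
  shows "CDF f g = 1 + 2 * (\<Sum>d\<in>{1..int l}. corr l f f d * corr l g g d) / real l ^ 2"
proof -
  have "(\<Sum>\<^sub>\<infinity>s. (cmod (crosscorr f g s))\<^sup>2) = (\<Sum>\<^sub>\<infinity>s\<in>{- int l..int l}. (corr l f g s)\<^sup>2)"
    by (rule infsum_cong_neutral)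
       (auto simp: crosscorr_eq_corr[OF assms(1,2)] intro!: corr_eq_0[OF assms(1)])
  moreover have "Re (crosscorr f f 0) * Re (crosscorr g g 0) = real l ^ 2"
    using assms(1,2) by (simp add: crosscorr_eq_corr corr_self_0 power2_eq_square)
  ultimately show ?thesis
    using assms(3) by (simp add: CDF_def sum_corr_square_split[OF assms(1,2)] add_divide_distrib)
qed

text \<open>Negating the entry at \<open>m\<close> is an involution of \<open>binary_seqs l\<close>,
  also for \<open>m\<close> outside the window, where the entry is 0.\<close>

lemma sum_binary_seqs_flip:
  fixes P :: "(int \<Rightarrow> complex) \<Rightarrow> real"
  assumes "\<And>f. P (f(m := - f m)) = - P f"
  shows "(\<Sum>f\<in>binary_seqs l. P f) = 0"
proof -
  have "(\<Sum>f\<in>binary_seqs l. P f) = (\<Sum>f\<in>binary_seqs l. - P f)"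
    by (rule sum.reindex_bij_witness[where i = "\<lambda>f. f(m := - f m)" and j = "\<lambda>f. f(m := - f m)"])
       (auto simp: assms binary_seqs_def)
  then show ?thesis
    by (simp add: sum_negf)
qed

lemma sum_corr_self:
  assumes "d > 0"
  shows "(\<Sum>f\<in>binary_seqs l. corr l f f d) = 0"
  unfolding corr_def
  by (subst sum.swap, rule sum.neutral, rule ballI, rule sum_binary_seqs_flip)
     (use assms in auto)

text \<open>The sum vanishes by a sign flip as soon as some position occurs exactly once among the
  four: the smaller of \<open>u\<close> and \<open>v\<close> if they differ, or \<open>u + d\<close>
  if \<open>u = v\<close> and \<open>d \<noteq> e\<close>. Otherwise the product consists of two
  squares and is 1 exactly when both positions lie in the window.\<close>

lemma sum_four_terms:
  assumes "d > 0" "e > 0"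
  shows "(\<Sum>f\<in>binary_seqs l. Re (f (u + d)) * Re (f u) * (Re (f (v + e)) * Re (f v)))
    = (if u = v \<and> d = e \<and> u \<in> {0..<int l} \<and> u + d < int l then 2 ^ l else 0)"
proof -
  let ?P = "\<lambda>f. Re (f (u + d)) * Re (f u) * (Re (f (v + e)) * Re (f v))"
  consider "u < v" | "v < u" | "u = v" "d \<noteq> e" | "u = v" "d = e"
    by linarith
  then show ?thesis
  proof cases
    case 1
    then show ?thesis
      using assms sum_binary_seqs_flip[of ?P u l] by auto
  next
    case 2
    then show ?thesis
      using assms sum_binary_seqs_flip[of ?P v l] by auto
  next
    case 3
    then show ?thesis
      using assms sum_binary_seqs_flip[of ?P "u + d" l] by auto
  next
    case 4
    have "?P f = (Re (f (u + d)))\<^sup>2 * (Re (f u))\<^sup>2" for f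
      using 4 by (simp add: power2_eq_square)
    then have "sum ?P (binary_seqs l)
        = (\<Sum>f\<in>binary_seqs l. if u \<in> {0..<int l} \<and> u + d < int l then 1 else 0)"
      using assms by (intro sum.cong) (auto simp: binary_seqs_Re_square)
    then show ?thesis
      using 4 by (simp add: card_binary_seqs)
  qed
qed

text \<open>Only the diagonal \<open>u = v\<close> with \<open>d = e\<close> survives, and
  \<open>l - d\<close> counts the positions \<open>u\<close> for which \<open>u\<close> and
  \<open>u + d\<close> both lie in the window. The shift \<open>d = l\<close> gets weight 0.\<close>

lemma sum_corr_self_product:
  assumes d: "d \<in> {1..int l}" and e: "e \<in> {1..int l}"
  shows "(\<Sum>f\<in>binary_seqs l. corr l f f d * corr l f f e)
    = (if d = e then 2 ^ l * (real l - of_int d) else 0)"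
proof -
  let ?I = "{0..<int l}"
  have "(\<Sum>f\<in>binary_seqs l. corr l f f d * corr l f f e)
      = (\<Sum>u\<in>?I. \<Sum>v\<in>?I. \<Sum>f\<in>binary_seqs l.
          Re (f (u + d)) * Re (f u) * (Re (f (v + e)) * Re (f v)))"
    unfolding corr_def sum_product by (subst sum.swap, rule sum.cong[OF refl sum.swap])
  also have "\<dots> = (\<Sum>u\<in>?I. \<Sum>v\<in>?I.
      if u = v then (if d = e \<and> u + d < int l then 2 ^ l else 0) else 0)"
    using d e by (intro sum.cong refl) (auto simp: sum_four_terms)
  also have "\<dots> = (\<Sum>u\<in>?I. if d = e \<and> u + d < int l then 2 ^ l else 0)"
    by (intro sum.cong refl) (simp add: sum.delta)
  also have "\<dots> = (if d = e then (\<Sum>u\<in>{0..<int l - d}. 2 ^ l) else 0)"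
  proof (cases "d = e")
    case True
    have "?I \<inter> {u. u + d < int l} = {0..<int l - d}"
      using d by auto
    then show ?thesis
      using True by (simp add: sum.If_cases)
  qed simp
  also have "\<dots> = (if d = e then 2 ^ l * (real l - of_int d) else 0)"
    using d by auto
  finally show ?thesis .
qed

lemma pair_expectation_eq:
  "pair_expectation l v = (\<Sum>f\<in>binary_seqs l. \<Sum>g\<in>binary_seqs l. v (f, g)) / 4 ^ l"
proof -
  have "pair_expectation l v = sum v (seq_pairs l) / real (card (seq_pairs l))"
    unfolding pair_expectation_def
    by (rule integral_pmf_of_set[OF seq_pairs_nonempty finite_seq_pairs])
  then show ?thesis
    unfolding card_seq_pairs by (simp add: seq_pairs_def sum.cartesian_product power_mult)
qed

text \<open>With \<open>k = l - d\<close> this is the sum of the squares of 0 to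
  \<open>l - 1\<close>.\<close>

lemma sum_squares_reversed:
  "(\<Sum>d\<in>{1..int l}. (real l - of_int d)\<^sup>2)
    = (2 * real l ^ 3 - 3 * real l ^ 2 + real l) / 6"
proof -
  have "(\<Sum>d\<in>{1..int l}. (real l - of_int d)\<^sup>2) = (\<Sum>k<l. (real k)\<^sup>2)"
    by (rule sum.reindex_bij_witness[where i = "\<lambda>k. int l - int k"
        and j = "\<lambda>d. nat (int l - d)"]) auto
  also have "\<dots> = (2 * real l ^ 3 - 3 * real l ^ 2 + real l) / 6"
    by (induction l) (auto simp: field_simps power2_eq_square power3_eq_cube)
  finally show ?thesis .
qed

theorem theorem1p2:
  fixes l :: nat
  assumes "l > 0"
  shows "central_moment 2 l (\<lambda>(f, g). CDF f g)
    = (4 * real l ^ 3 - 6 * real l ^ 2 + 2 * real l) / (3 * real l ^ 4)"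
proof -
  let ?B = "binary_seqs l" and ?D = "{1..int l}"
  let ?X = "\<lambda>f g. \<Sum>d\<in>?D. corr l f f d * corr l g g d"
  have four: "(4::real) ^ l = 2 ^ l * 2 ^ l"
    by (simp flip: power_mult_distrib)
  have mean0: "(\<Sum>f\<in>?B. \<Sum>g\<in>?B. ?X f g) = 0"
  proof -
    \<comment> \<open>The average over \<open>g\<close> alone already vanishes, whatever
      \<open>f\<close> is.\<close>
    have "(\<Sum>g\<in>?B. ?X f g) = 0" for f
      by (subst sum.swap) (auto simp: sum_corr_self simp flip: sum_distrib_left)
    then show ?thesis
      by simp
  qed
  have "(\<Sum>f\<in>?B. \<Sum>g\<in>?B. CDF f g) = (\<Sum>f\<in>?B. \<Sum>g\<in>?B. 1 + 2 / real l ^ 2 * ?X f g)"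
    by (intro sum.cong refl) (simp add: CDF_eq[OF _ _ assms])
  also have "\<dots> = 4 ^ l"
    unfolding sum.distrib sum_distrib_left[symmetric] mean0
    by (simp add: card_binary_seqs four)
  finally have mean: "pair_expectation l (\<lambda>(f, g). CDF f g) = 1"
    by (simp add: pair_expectation_eq)
  have "(\<Sum>f\<in>?B. \<Sum>g\<in>?B. (?X f g)\<^sup>2)
      = (\<Sum>d\<in>?D. \<Sum>e\<in>?D. \<Sum>f\<in>?B. \<Sum>g\<in>?B.
          (corr l f f d * corr l f f e) * (corr l g g d * corr l g g e))"
    unfolding power2_eq_square sum_product
    by (simp only: sum.swap[of _ ?D ?B] mult_ac)
  \<comment> \<open>This is where independence enters: for fixed \<open>d\<close> and
    \<open>e\<close> the double sum factors into two identical sums over \<open>?B\<close>.\<close>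
  also have "\<dots> = (\<Sum>d\<in>?D. \<Sum>e\<in>?D. (\<Sum>f\<in>?B. corr l f f d * corr l f f e)\<^sup>2)"
    by (simp add: power2_eq_square sum_product)
  also have "\<dots> = (\<Sum>d\<in>?D. \<Sum>e\<in>?D. if d = e then 4 ^ l * (real l - of_int d)\<^sup>2 else 0)"
    by (intro sum.cong refl) (simp add: sum_corr_self_product four power2_eq_square)
  also have "\<dots> = 4 ^ l * (\<Sum>d\<in>?D. (real l - of_int d)\<^sup>2)"
    by (simp add: sum.delta sum_distrib_left)
  finally have second: "(\<Sum>f\<in>?B. \<Sum>g\<in>?B. (?X f g)\<^sup>2)
      = 4 ^ l * ((2 * real l ^ 3 - 3 * real l ^ 2 + real l) / 6)"
    by (simp only: sum_squares_reversed)
  \<comment> \<open>The factor \<open>4 / real l ^ 4\<close> is the square of the coefficient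
    \<open>2 / real l ^ 2\<close> of \<open>?X f g\<close> in \<open>CDF f g - 1\<close>.\<close>
  have "(\<Sum>f\<in>?B. \<Sum>g\<in>?B. (CDF f g - 1)\<^sup>2) = (\<Sum>f\<in>?B. \<Sum>g\<in>?B. 4 / real l ^ 4 * (?X f g)\<^sup>2)"
    by (intro sum.cong refl) (simp add: CDF_eq[OF _ _ assms] power_divide power_mult_distrib)
  also have "\<dots> = 4 / real l ^ 4 * (4 ^ l * ((2 * real l ^ 3 - 3 * real l ^ 2 + real l) / 6))"
    by (simp only: second flip: sum_distrib_left)
  finally have "central_moment 2 l (\<lambda>(f, g). CDF f g)
      = 4 / real l ^ 4 * (4 ^ l * ((2 * real l ^ 3 - 3 * real l ^ 2 + real l) / 6)) / 4 ^ l"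
    unfolding central_moment_def mean by (simp only: pair_expectation_eq prod.case)
  also have "\<dots> = 2 * (2 * real l ^ 3 - 3 * real l ^ 2 + real l) / (3 * real l ^ 4)"
    by simp
  also have "2 * (2 * real l ^ 3 - 3 * real l ^ 2 + real l)
      = 4 * real l ^ 3 - 6 * real l ^ 2 + 2 * real l"
    by simp
  finally show ?thesis .
qed

end
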